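(* Let $k>1$ be an integer, let $p:\mathbb{N}\to[0,1]$ and for $N\ge 1$ let $G(N,p(N))$ be the random graph on vertex set $\{0,1,\dots,N-1\}$ in which each pair of distinct vertices is joined by an edge independently with probability $p(N)$. Suppose that $p(N)$ satisfies one of the following conditions: (1) $p(N)\ll N^{-2}$; (2) for some integer $j$, $N^{-1-\frac1j}\ll p(N)\ll N^{-1-\frac{1}{j-1}}$; (3) $N^{-1-\epsilon}\ll p(N)\ll N^{-1}$ for all $\epsilon>0$; (4) $N^{-1}\ll p(N)\ll N^{-1}\log N$. Then the probability that the robber has a winning strategy in the cops and robber game with $k$ cops and one robber played on $G(N,p(N))$ tends to $1$ as $N\to\infty$.
   Context: For functions $a,b$, $a(N)\ll b(N)$ means $\lim_{N\to\infty} a(N)/b(N)=0$. Cops and robber game on a finite simple graph $G$: graphs are treated as reflexive, i.e. a player may stay at its current vertex as a move. There are $k$ cops and one robber occupying vertices; the game is played with perfect information in a countable sequence of rounds, cops and robber moving alternately; in the cops' turn all cops move simultaneously, each along an edge to an adjacent vertex or staying put, and in the robber's turn he moves along an edge to an adjacent vertex or stays put. The cops win if after some finite number of rounds at least one cop occupies the same vertex as the robber; the robber wins if he avoids the cops forever in an infinite play.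
   Formalization: Condition (2) as printed holds for no p when j is not 0 or 1, and an exponent is undefined for j = 0, 1; the formal version excludes j = 0, 1 in the printed condition and also allows the intended range N^{-1-1/j} ≪ p(N) ≪ N^{-1-1/(j+1)} with j ≥ 1. *)

theory Defs
  imports "HOL-Probability.Probability"
begin

text \<open>\<open>a(N) / b(N) \<longlongrightarrow> 0\<close>. The first conjunct says that the quotient is eventually defined;
  without it the convention \<open>x / 0 = 0\<close> would make every sequence negligible against \<open>0\<close>.\<close>

definition much_less :: "(nat \<Rightarrow> real) \<Rightarrow> (nat \<Rightarrow> real) \<Rightarrow> bool"  (infix "\<lless>" 50) where
  "a \<lless> b \<longleftrightarrow> (\<forall>\<^sub>F N in sequentially. b N \<noteq> 0) \<and> (\<lambda>N. a N / b N) \<longlonglongrightarrow> 0"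

text \<open>A finite simple graph is given by a vertex set and a set of two-element sets of vertices.\<close>

definition vertex_pairs :: "'a set \<Rightarrow> 'a set set" where
  "vertex_pairs V = {e. e \<subseteq> V \<and> card e = 2}"

text \<open>The edge set of the random graph on \<open>{..<N}\<close>: one independent coin per pair of vertices.\<close>

definition random_graph :: "nat \<Rightarrow> real \<Rightarrow> nat set set pmf" where
  "random_graph N q =
     map_pmf (\<lambda>X. {e \<in> vertex_pairs {..<N}. X e})
       (Pi_pmf (vertex_pairs {..<N}) False (\<lambda>_. bernoulli_pmf q))"

definition legal_move :: "'a set set \<Rightarrow> 'a \<Rightarrow> 'a \<Rightarrow> bool" where
  "legal_move E x y \<longleftrightarrow> x = y \<or> {x, y} \<in> E"

text \<open>Round \<open>0\<close> is the placement: the cops choose their vertices, then the robber, knowing them,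
  chooses his. In each later round the cops move first and the robber answers.
  The list \<open>c n\<close> holds the positions of the \<open>k\<close> cops after their turn in round \<open>n\<close>.\<close>

definition cop_play :: "nat \<Rightarrow> 'a set \<Rightarrow> 'a set set \<Rightarrow> (nat \<Rightarrow> 'a list) \<Rightarrow> bool" where
  "cop_play k V E c \<longleftrightarrow>
     (\<forall>n. length (c n) = k \<and> set (c n) \<subseteq> V \<and> list_all2 (legal_move E) (c n) (c (Suc n)))"

text \<open>A robber strategy maps the history of the cops' positions, up to and including their latest
  turn, to the robber's next position. His own earlier positions are determined by that history
  and the strategy, so this is the full information about the play.\<close>

type_synonym 'a robber_strategy = "'a list list \<Rightarrow> 'a"

definition robber_play :: "'a robber_strategy \<Rightarrow> (nat \<Rightarrow> 'a list) \<Rightarrow> nat \<Rightarrow> 'a" where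
  "robber_play s c n = s (map c [0..<Suc n])"

text \<open>The last two conjuncts exclude capture after the robber's turn in round \<open>n\<close> and after the
  cops' turn in round \<open>n + 1\<close>, respectively.\<close>

definition winning_robber_strategy ::
    "nat \<Rightarrow> 'a set \<Rightarrow> 'a set set \<Rightarrow> 'a robber_strategy \<Rightarrow> bool" where
  "winning_robber_strategy k V E s \<longleftrightarrow>
     (\<forall>c. cop_play k V E c \<longrightarrow>
       (\<forall>n. robber_play s c n \<in> V \<and>
            legal_move E (robber_play s c n) (robber_play s c (Suc n)) \<and>
            robber_play s c n \<notin> set (c n) \<and>
            robber_play s c n \<notin> set (c (Suc n))))"

definition robber_wins :: "nat \<Rightarrow> 'a set \<Rightarrow> 'a set set \<Rightarrow> bool" where
  "robber_wins k V E \<longleftrightarrow> (\<exists>s. winning_robber_strategy k V E s)"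

text \<open>The second range of edge probabilities, between consecutive thresholds \<open>N powr (-1 - 1/j)\<close>.
  It is printed as the first disjunct, where \<open>j = 0\<close> and \<open>j = 1\<close> are excluded because the
  exponents are undefined. The printed bounds are in the wrong order: for every other \<open>j\<close> they are
  incompatible, since \<open>-1 - 1/j > -1 - 1/(j - 1)\<close>. The second disjunct is the
  range that is evidently meant.\<close>

definition between_thresholds :: "(nat \<Rightarrow> real) \<Rightarrow> bool" where
  "between_thresholds p \<longleftrightarrow>
     (\<exists>j::int. j \<noteq> 0 \<and> j \<noteq> 1 \<and>
        (\<lambda>N. real N powr (- 1 - 1 / real_of_int j)) \<lless> p \<and>
        p \<lless> (\<lambda>N. real N powr (- 1 - 1 / (real_of_int j - 1)))) \<or>
     (\<exists>j::int. j \<ge> 1 \<and>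
        (\<lambda>N. real N powr (- 1 - 1 / real_of_int j)) \<lless> p \<and>
        p \<lless> (\<lambda>N. real N powr (- 1 - 1 / (real_of_int j + 1))))"

end

theory Submission
  imports Defs "HOL-Real_Asymp.Real_Asymp"
begin

text \<open>A robber on an isolated vertex that carries no cop at the start is never caught, so he wins
  as soon as there are more than \<open>k\<close> isolated vertices. Every one of the ranges allowed for \<open>p\<close>
  satisfies \<open>p \<lless> ln N / N\<close>, and there the expected number
  \<open>\<mu> = N (1 - p) ^ (N - 1)\<close> of isolated vertices tends to infinity. For \<open>p \<le> 1/2\<close> its variance
  is at most \<open>\<mu> + 2 p \<mu>\<^sup>2\<close>, because the stars of two vertices share a single pair.
  Chebyshev's inequality finishes the proof.\<close>

section \<open>Isolated vertices and the pairs meeting a vertex\<close>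

definition isolated_vertices :: "'a set \<Rightarrow> 'a set set \<Rightarrow> 'a set" where
  "isolated_vertices V E = {v \<in> V. \<forall>e\<in>E. v \<notin> e}"

text \<open>The coins that must all fail for \<open>v\<close> to be isolated: isolation becomes an
  event about a fixed set of independent coins.\<close>

definition star_pairs :: "'a set \<Rightarrow> 'a \<Rightarrow> 'a set set" where
  "star_pairs V v = {e \<in> vertex_pairs V. v \<in> e}"

lemma finite_vertex_pairs [simp]: "finite V \<Longrightarrow> finite (vertex_pairs V)"
  unfolding vertex_pairs_def by (rule finite_subset[of _ "Pow V"]) auto

lemma star_pairs_subset: "star_pairs V v \<subseteq> vertex_pairs V"
  by (auto simp: star_pairs_def)

lemma star_pairs_eq_image:
  assumes "v \<in> V"
  shows "star_pairs V v = (\<lambda>w. {v, w}) ` (V - {v})"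
proof
  show "star_pairs V v \<subseteq> (\<lambda>w. {v, w}) ` (V - {v})"
    by (auto simp: star_pairs_def vertex_pairs_def card_2_iff)
  show "(\<lambda>w. {v, w}) ` (V - {v}) \<subseteq> star_pairs V v"
    using assms by (auto simp: star_pairs_def vertex_pairs_def card_2_iff)
qed

lemma card_star_pairs:
  assumes "v \<in> V"
  shows "card (star_pairs V v) = card V - 1"
proof -
  have "inj_on (\<lambda>w. {v, w}) (V - {v})"
    by (auto simp: inj_on_def doubleton_eq_iff)
  then show ?thesis
    using assms by (simp add: star_pairs_eq_image card_image card_Diff_singleton)
qed

lemma card_star_pairs_Un:
  assumes "finite V" "v \<in> V" "w \<in> V" "v \<noteq> w"
  shows "card (star_pairs V v \<union> star_pairs V w) = 2 * card V - 3"
proof -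
  have fin: "finite (star_pairs V u)" for u
    using assms(1) star_pairs_subset by (metis finite_subset finite_vertex_pairs)
  have "star_pairs V v \<inter> star_pairs V w = {{v, w}}"
    using assms by (auto simp: star_pairs_def vertex_pairs_def card_2_iff)
  \<comment> \<open>The additive form \<open>+ 1\<close> forces \<open>card V\<close> to be at least
    2, so truncated subtraction is harmless in the final count.\<close>
  then have "card (star_pairs V v \<union> star_pairs V w) + 1 = 2 * (card V - 1)"
    using card_Un_Int[OF fin fin, of v w] assms by (simp add: card_star_pairs)
  then show ?thesis by linarith
qed

lemma isolated_iff_disjoint_star:
  assumes "E \<subseteq> vertex_pairs V"
  shows "v \<in> isolated_vertices V E \<longleftrightarrow> v \<in> V \<and> E \<inter> star_pairs V v = {}"
  using assms by (auto simp: isolated_vertices_def star_pairs_def)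

section \<open>The robber's strategy of staying put\<close>

lemma robber_wins_if_many_isolated:
  assumes "k < card (isolated_vertices V E)"
  shows "robber_wins k V E"
proof -
  \<comment> \<open>Only \<open>hd h\<close>, the initial placement of the cops, is consulted, so
    the chosen vertex never changes during a play.\<close>
  define s :: "'a robber_strategy" where
    "s = (\<lambda>h. SOME v. v \<in> isolated_vertices V E - set (hd h))"
  have "robber_play s c n \<in> V \<and> legal_move E (robber_play s c n) (robber_play s c (Suc n)) \<and>
      robber_play s c n \<notin> set (c n) \<and> robber_play s c n \<notin> set (c (Suc n))"
    if play: "cop_play k V E c" for c n
  proof -
    define v where "v = (SOME v. v \<in> isolated_vertices V E - set (c 0))"
    have stay: "robber_play s c m = v" for m
      unfolding robber_play_def s_def v_def by (simp add: hd_map del: upt_Suc)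
    have "card (set (c 0)) < card (isolated_vertices V E)"
      using play assms card_length[of "c 0"] unfolding cop_play_def by (metis order_le_less_trans)
    then have "\<exists>v. v \<in> isolated_vertices V E - set (c 0)"
      by (metis DiffI List.finite_set card_mono linorder_not_less subsetI)
    then have v: "v \<in> isolated_vertices V E - set (c 0)"
      unfolding v_def by (rule someI_ex)
    \<comment> \<open>A cop arriving at \<open>v\<close> would need an edge at \<open>v\<close>;
      since there is none, it would have stood there one round earlier.\<close>
    have avoid: "v \<notin> set (c m)" for m
    proof (induction m)
      case 0
      then show ?case using v by simp
    next
      case (Suc m)
      have moves: "list_all2 (legal_move E) (c m) (c (Suc m))"
        using play by (simp add: cop_play_def)
      show ?case
      proof
        assume "v \<in> set (c (Suc m))"
        then obtain x where "x \<in> set (c m)" "legal_move E x v"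
          using moves by (metis in_set_conv_nth list_all2_conv_all_nth)
        then show False
          using Suc v by (auto simp: legal_move_def isolated_vertices_def)
      qed
    qed
    have "v \<in> V" using v by (simp add: isolated_vertices_def)
    then show ?thesis by (simp add: stay avoid legal_move_def)
  qed
  then show ?thesis
    unfolding robber_wins_def winning_robber_strategy_def by blast
qed

section \<open>The second moment of the number of isolated vertices\<close>

lemma finite_set_random_graph: "finite (set_pmf (random_graph N q))"
  by (rule finite_subset[of _ "Pow (vertex_pairs {..<N})"]) (auto simp: random_graph_def)

lemma prob_random_graph_disjoint:
  assumes "0 \<le> q" "q \<le> 1" "F \<subseteq> vertex_pairs {..<N}"
  shows "measure_pmf.prob (random_graph N q) {E. E \<inter> F = {}} = (1 - q) ^ card F"
proof -
  let ?P = "vertex_pairs {..<N}"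
  let ?B = "\<lambda>e. if e \<in> F then {False} else UNIV"
  \<comment> \<open>In coin space the event is a box: coins in \<open>F\<close> must show
    \<open>False\<close>, all others are free. The product measure therefore factors.\<close>
  have "(\<lambda>X. {e \<in> ?P. X e}) -` {E. E \<inter> F = {}} = Pi ?P ?B"
    using assms(3) by (auto simp: Pi_def)
  then have "measure_pmf.prob (random_graph N q) {E. E \<inter> F = {}}
      = (\<Prod>e\<in>?P. measure_pmf.prob (bernoulli_pmf q) (?B e))"
    unfolding random_graph_def by (simp add: measure_Pi_pmf_Pi)
  also have "\<dots> = (\<Prod>e\<in>?P. if e \<in> F then 1 - q else 1)"
    using assms by (intro prod.cong) (auto simp: measure_pmf_single)
  also have "\<dots> = (\<Prod>e\<in>?P \<inter> F. 1 - q)"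
    by (simp add: prod.If_cases)
  also have "?P \<inter> F = F" using assms(3) by blast
  finally show ?thesis by simp
qed

text \<open>Since \<open>k\<close> is at most \<open>\<mu> / 2\<close>, having at most
  \<open>k\<close> isolated vertices is a deviation of at least \<open>\<mu> / 2\<close> from the
  mean. Dividing the variance bound by \<open>(\<mu> / 2)\<^sup>2\<close> gives the two
  terms.\<close>

lemma prob_few_isolated_le:
  assumes q: "0 \<le> q" "q \<le> 1/2" and N: "N \<ge> 2"
    and \<mu>: "\<mu> = real N * (1 - q) ^ (N - 1)" "2 * real k \<le> \<mu>"
  shows "measure_pmf.prob (random_graph N q)
      {E. card (isolated_vertices {..<N} E) \<le> k} \<le> 4 / \<mu> + 8 * q"
proof -
  let ?G = "random_graph N q" and ?V = "{..<N}"
  let ?pr = "measure_pmf.prob ?G" and ?ex = "measure_pmf.expectation ?G"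
  define A where "A v = {E. E \<inter> star_pairs ?V v = {}}" for v
  define X :: "nat set set \<Rightarrow> real" where "X E = (\<Sum>v<N. indicator (A v) E)" for E
  have int: "integrable ?G f" for f :: "nat set set \<Rightarrow> real"
    by (rule integrable_measure_pmf_finite[OF finite_set_random_graph])
  have \<mu>_pos: "\<mu> > 0" using \<mu>(1) q N by simp
  have pA: "?pr (A v) = (1 - q) ^ (N - 1)" if "v < N" for v
    unfolding A_def using prob_random_graph_disjoint[of q "star_pairs ?V v" N] star_pairs_subset[of ?V v] q that
    by (simp add: card_star_pairs)
  have pAA: "?pr (A v \<inter> A w) = (1 - q) ^ (2 * N - 3)" if "v < N" "w < N" "v \<noteq> w" for v w
  proof -
    have "A v \<inter> A w = {E. E \<inter> (star_pairs ?V v \<union> star_pairs ?V w) = {}}"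
      by (auto simp: A_def)
    then show ?thesis
      using prob_random_graph_disjoint[of q "star_pairs ?V v \<union> star_pairs ?V w" N] q that
      by (simp add: card_star_pairs_Un star_pairs_subset)
  qed
  have EX: "?ex X = \<mu>"
  proof -
    have "?ex X = (\<Sum>v<N. ?pr (A v))"
      unfolding X_def by (simp add: Bochner_Integration.integral_sum int)
    also have "\<dots> = \<mu>" by (simp add: pA \<mu>(1))
    finally show ?thesis .
  qed
  \<comment> \<open>As \<open>q \<le> 1/2\<close>, the factor \<open>2 * (1 - q)\<close> is at least
    1. This pays for raising the exponent to \<open>2 * N - 2\<close>, the one occurring in
    \<open>\<mu>\<^sup>2\<close>.\<close>
  have "(1 - q) ^ (2 * N - 3) * 1 \<le> (1 - q) ^ (2 * N - 3) * (2 * (1 - q))"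
    using q by (intro mult_left_mono) auto
  moreover have "2 * N - 2 = Suc (2 * N - 3)" using N by linarith
  ultimately have step: "(1 - q) ^ (2 * N - 3) \<le> 2 * (1 - q) ^ (2 * N - 2)"
    "(1 - q) ^ (2 * N - 2) = (1 - q) ^ (2 * N - 3) * (1 - q)"
    by (simp_all add: algebra_simps)
  have \<mu>2: "\<mu>\<^sup>2 = (real N)\<^sup>2 * (1 - q) ^ (2 * N - 2)"
    by (simp add: \<mu>(1) power_mult_distrib diff_mult_distrib mult.commute[of 2] flip: power_mult)
  have "?ex (\<lambda>E. (X E)\<^sup>2) = (\<Sum>v<N. \<Sum>w<N. ?pr (A v \<inter> A w))"
  proof -
    have "(X E)\<^sup>2 = (\<Sum>v<N. \<Sum>w<N. indicator (A v \<inter> A w) E)" for E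
      by (simp add: X_def power2_eq_square sum_product indicator_inter_arith)
    then show ?thesis by (simp add: Bochner_Integration.integral_sum int)
  qed
  \<comment> \<open>The diagonal terms add up to \<open>\<mu>\<close>. The off-diagonal value is
    charged on the diagonal as well, so that it is summed over all pairs
    \<open>(v, w)\<close>.\<close>
  also have "\<dots> \<le> (\<Sum>v<N. \<Sum>w<N. (if v = w then (1 - q) ^ (N - 1) else 0) + (1 - q) ^ (2 * N - 3))"
    using q by (intro sum_mono) (auto simp: pA pAA)
  also have "\<dots> = \<mu> + (real N)\<^sup>2 * (1 - q) ^ (2 * N - 3)"
    by (simp add: sum.distrib \<mu>(1) power2_eq_square distrib_left)
  finally have "measure_pmf.variance ?G X \<le> \<mu> + (real N)\<^sup>2 * (1 - q) ^ (2 * N - 3) - \<mu>\<^sup>2"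
    by (subst measure_pmf.variance_eq[OF int int]) (simp add: EX)
  \<comment> \<open>The pair shared by two stars is one coin instead of two; this gap of one in the
    exponent leaves the factor \<open>q\<close>.\<close>
  also have "\<dots> = \<mu> + (real N)\<^sup>2 * (q * (1 - q) ^ (2 * N - 3))"
    unfolding \<mu>2 step(2) by (simp add: algebra_simps)
  also have "\<dots> \<le> \<mu> + (real N)\<^sup>2 * (q * (2 * (1 - q) ^ (2 * N - 2)))"
    using q step(1) by (intro add_left_mono mult_left_mono) auto
  also have "\<dots> = \<mu> + 2 * q * \<mu>\<^sup>2" by (simp add: \<mu>2)
  finally have var: "measure_pmf.variance ?G X \<le> \<mu> + 2 * q * \<mu>\<^sup>2" .
  \<comment> \<open>Restricting to the support matters: a singleton \<open>{v}\<close> in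
    \<open>E\<close> would spoil isolation of \<open>v\<close> without being seen by
    \<open>star_pairs\<close>. Hence the comparison of events below is only almost sure.\<close>
  have X_eq: "X E = real (card (isolated_vertices ?V E))" if "E \<in> set_pmf ?G" for E
  proof -
    have "E \<subseteq> vertex_pairs ?V" using that by (auto simp: random_graph_def)
    then have "isolated_vertices ?V E = {v \<in> ?V. E \<in> A v}"
      using isolated_iff_disjoint_star[of E ?V] unfolding A_def by blast
    then show ?thesis
      by (simp add: X_def indicator_def sum.If_cases Int_def)
  qed
  have "?pr {E. card (isolated_vertices ?V E) \<le> k} \<le> ?pr {E. \<mu> / 2 \<le> \<bar>X E - ?ex X\<bar>}"
    using X_eq EX \<mu>(2) by (intro measure_pmf.finite_measure_mono_AE) (auto simp: AE_measure_pmf_iff)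
  also have "\<dots> \<le> measure_pmf.variance ?G X / (\<mu> / 2)\<^sup>2"
    using measure_pmf.Chebyshev_inequality[of X ?G "\<mu> / 2"] \<mu>_pos int by simp
  also have "\<dots> \<le> (\<mu> + 2 * q * \<mu>\<^sup>2) / (\<mu> / 2)\<^sup>2"
    using var by (intro divide_right_mono) auto
  also have "\<dots> = 4 / \<mu> + 8 * q"
    using \<mu>_pos by (simp add: field_simps power2_eq_square)
  finally show ?thesis .
qed

section \<open>Comparison of growth rates\<close>

lemma much_less_trans:
  assumes "a \<lless> b" "b \<lless> c"
  shows "a \<lless> c"
proof -
  have "(\<lambda>N. (a N / b N) * (b N / c N)) \<longlonglongrightarrow> 0 * 0"
    using assms unfolding much_less_def by (intro tendsto_mult) auto
  \<comment> \<open>Cancelling \<open>b N\<close> is legitimate because \<open>a \<lless> b\<close>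
    includes that \<open>b\<close> is eventually nonzero.\<close>
  moreover have "\<forall>\<^sub>F N in sequentially. (a N / b N) * (b N / c N) = a N / c N"
    using assms(1) unfolding much_less_def by (auto elim: eventually_mono)
  ultimately have "(\<lambda>N. a N / c N) \<longlonglongrightarrow> 0"
    unfolding mult_zero_left by (rule Lim_transform_eventually)
  then show ?thesis using assms(2) by (simp add: much_less_def)
qed

text \<open>The quotient is a power with exponent \<open>a - b\<close>, which stays at least 1 when
  \<open>a \<ge> b\<close>. The forward direction serves to extract an inequality of exponents from
  a pair of threshold bounds.\<close>

lemma powr_much_less_powr_iff:
  "(\<lambda>N. real N powr a) \<lless> (\<lambda>N. real N powr b) \<longleftrightarrow> a < b"
proof -
  have ne: "\<forall>\<^sub>F N in sequentially. real N powr b \<noteq> 0"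
    using eventually_gt_at_top[of 0] by eventually_elim simp
  have quot: "(\<lambda>N. real N powr a / real N powr b) = (\<lambda>N. real N powr (a - b))"
    by (simp add: powr_diff)
  have "\<not> (\<lambda>N. real N powr (a - b)) \<longlonglongrightarrow> 0" if "a \<ge> b"
  proof
    assume "(\<lambda>N. real N powr (a - b)) \<longlonglongrightarrow> 0"
    then have "\<forall>\<^sub>F N in sequentially. real N powr (a - b) < 1"
      by (rule order_tendstoD) simp
    moreover have "\<forall>\<^sub>F N in sequentially. real N powr (a - b) \<ge> 1"
      using eventually_ge_at_top[of 1] by eventually_elim (use that in \<open>simp add: ge_one_powr_ge_zero\<close>)
    ultimately have "\<forall>\<^sub>F N :: nat in sequentially. False"
      by eventually_elim simp
    then show False by simp
  qed
  moreover have "(\<lambda>N. real N powr (a - b)) \<longlonglongrightarrow> 0" if "a < b"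
    using that by real_asymp
  ultimately show ?thesis
    unfolding much_less_def quot using ne by (meson not_le)
qed

text \<open>For exponent -1 the quotient is eventually \<open>1 / ln (real N)\<close>; smaller
  exponents follow by transitivity.\<close>

lemma powr_much_less_log:
  assumes "a \<le> -1"
  shows "(\<lambda>N. real N powr a) \<lless> (\<lambda>N. real N powr (- 1) * ln (real N))"
proof -
  have base: "(\<lambda>N. real N powr (- 1)) \<lless> (\<lambda>N. real N powr (- 1) * ln (real N))"
    unfolding much_less_def
  proof
    show "\<forall>\<^sub>F N in sequentially. real N powr (- 1) * ln (real N) \<noteq> 0"
      using eventually_gt_at_top[of 1] by eventually_elim simp
    show "(\<lambda>N. real N powr (- 1) / (real N powr (- 1) * ln (real N))) \<longlonglongrightarrow> 0"
      by real_asymp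
  qed
  show ?thesis
  proof (cases "a = -1")
    case True
    then show ?thesis using base by simp
  next
    case False
    then have "(\<lambda>N. real N powr a) \<lless> (\<lambda>N. real N powr (- 1))"
      using assms by (simp only: powr_much_less_powr_iff)
    then show ?thesis using base by (rule much_less_trans)
  qed
qed

lemma between_thresholds_much_less_log:
  assumes "between_thresholds p"
  shows "p \<lless> (\<lambda>N. real N powr (- 1) * ln (real N))"
proof -
  obtain a where "a \<le> -1" "p \<lless> (\<lambda>N. real N powr a)"
  proof -
    consider (printed) j :: int where "j \<noteq> 0" "j \<noteq> 1"
        "(\<lambda>N. real N powr (- 1 - 1 / real_of_int j)) \<lless> p"
        "p \<lless> (\<lambda>N. real N powr (- 1 - 1 / (real_of_int j - 1)))"
      | (meant) j :: int where "j \<ge> 1"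
        "p \<lless> (\<lambda>N. real N powr (- 1 - 1 / (real_of_int j + 1)))"
      using assms unfolding between_thresholds_def by blast
    then show ?thesis
    proof cases
      case printed
      have "- 1 - 1 / real_of_int j < - 1 - 1 / (real_of_int j - 1)"
        using much_less_trans[OF printed(3,4)] by (simp only: powr_much_less_powr_iff)
      then have lt: "1 / (real_of_int j - 1) < 1 / real_of_int j" by simp
      \<comment> \<open>In both cases \<open>j - 1\<close> and \<open>j\<close> have the same sign,
        so taking reciprocals reverses their order and contradicts \<open>lt\<close>: the printed
        range is empty.\<close>
      have "real_of_int j \<ge> 2 \<or> real_of_int j \<le> -1" using printed(1,2) by linarith
      then show ?thesis
        using lt by (auto simp: field_simps split: if_splits)
    next
      case meant
      then show ?thesis by (intro that[of "- 1 - 1 / (real_of_int j + 1)"]) auto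
    qed
  qed
  then show ?thesis using powr_much_less_log much_less_trans by blast
qed

section \<open>Growth of the expected number of isolated vertices\<close>

lemma exp_le_one_minus:
  fixes x :: real
  assumes "0 \<le> x" "x \<le> 1/2"
  shows "exp (- 2 * x) \<le> 1 - x"
proof -
  \<comment> \<open>This absorbs the quadratic term of the bound
    \<open>- x - 2 * x\<^sup>2 \<le> ln (1 - x)\<close> into a second copy of
    \<open>- x\<close>.\<close>
  have "x * x \<le> x * (1/2)" using assms by (intro mult_left_mono) auto
  then have "- 2 * x \<le> ln (1 - x)"
    using ln_one_minus_pos_lower_bound[OF assms] by (simp add: power2_eq_square)
  then show ?thesis using assms by (simp add: ln_ge_iff)
qed

text \<open>The constant 4 makes \<open>2 * q * real N\<close> at most
  \<open>ln (real N) / 2\<close>, so \<open>(1 - q) ^ N \<ge> exp (- 2 * q * real N)\<close> costs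
  at most a factor \<open>sqrt (real N)\<close>.\<close>

lemma sqrt_le_expected_isolated:
  assumes q: "0 \<le> q" "q \<le> 1/2" and N: "N \<ge> 1" and le: "q \<le> ln (real N) / (4 * real N)"
  shows "sqrt (real N) \<le> real N * (1 - q) ^ (N - 1)"
proof -
  have "sqrt (real N) = real N * exp (- ln (real N) / 2)"
    using N by (simp add: powr_half_sqrt[symmetric] powr_def exp_minus field_simps flip: exp_add)
  also have "\<dots> \<le> real N * exp (- 2 * q * real N)"
    using le N by (intro mult_left_mono) (auto simp: field_simps)
  also have "\<dots> = real N * exp (- 2 * q) ^ N"
    by (simp flip: exp_of_nat_mult add: mult_ac)
  also have "\<dots> \<le> real N * (1 - q) ^ N"
    using exp_le_one_minus[OF q] by (intro mult_left_mono power_mono) auto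
  also have "\<dots> \<le> real N * (1 - q) ^ (N - 1)"
    using q by (intro mult_left_mono power_decreasing) auto
  finally show ?thesis .
qed

theorem theorem10:
  fixes k :: nat and p :: "nat \<Rightarrow> real"
  assumes "k > 1"
    and "\<And>N. 0 \<le> p N \<and> p N \<le> 1"
    and "p \<lless> (\<lambda>N. real N powr (- 2)) \<or>
         between_thresholds p \<or>
         (\<forall>\<epsilon>>0. (\<lambda>N. real N powr (- 1 - \<epsilon>)) \<lless> p \<and> p \<lless> (\<lambda>N. real N powr (- 1))) \<or>
         ((\<lambda>N. real N powr (- 1)) \<lless> p \<and> p \<lless> (\<lambda>N. real N powr (- 1) * ln (real N)))"
  shows "(\<lambda>N. measure_pmf.prob (random_graph N (p N)) {E. robber_wins k {..<N} E})
           \<longlonglongrightarrow> 1"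
proof -
  have "p \<lless> (\<lambda>N. real N powr (- 1) * ln (real N))"
    using assms(3)
  proof (elim disjE conjE)
    assume "p \<lless> (\<lambda>N. real N powr (- 2))"
    then show ?thesis using much_less_trans powr_much_less_log[of "- 2"] by simp
  next
    assume "between_thresholds p"
    then show ?thesis by (rule between_thresholds_much_less_log)
  next
    assume "\<forall>\<epsilon>>0. (\<lambda>N. real N powr (- 1 - \<epsilon>)) \<lless> p \<and> p \<lless> (\<lambda>N. real N powr (- 1))"
    \<comment> \<open>The upper bound is read off at \<open>\<epsilon> = 1\<close>.\<close>
    then have "p \<lless> (\<lambda>N. real N powr (- 1))" using zero_less_one by blast
    then show ?thesis using much_less_trans powr_much_less_log[of "- 1"] by simp
  qed
  then have "(\<lambda>N. p N / (real N powr (- 1) * ln (real N))) \<longlonglongrightarrow> 0"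
    by (simp add: much_less_def)
  \<comment> \<open>The value 1/4 matches the hypothesis of
    \<open>sqrt_le_expected_isolated\<close>; for \<open>N > 1\<close> the logarithm is positive and
    can be multiplied out.\<close>
  then have "\<forall>\<^sub>F N in sequentially. p N / (real N powr (- 1) * ln (real N)) < 1/4"
    by (rule order_tendstoD) simp
  then have p_le: "\<forall>\<^sub>F N in sequentially. p N \<le> ln (real N) / (4 * real N)"
    using eventually_gt_at_top[of 1]
    by eventually_elim (simp add: powr_minus field_simps)
  have "\<forall>\<^sub>F N in sequentially. ln (real N) / (4 * real N) \<le> 1/2"
    by real_asymp
  moreover have "\<forall>\<^sub>F N in sequentially. 2 * real k \<le> sqrt (real N)"
    by real_asymp
  \<comment> \<open>Replacing \<open>\<mu>\<close> by \<open>sqrt (real N)\<close> and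
    \<open>p N\<close> by its upper bound makes the error term explicit in \<open>N\<close>, with
    limit 0.\<close>
  ultimately have lower: "\<forall>\<^sub>F N in sequentially.
      1 - (4 / sqrt (real N) + 8 * (ln (real N) / (4 * real N)))
        \<le> measure_pmf.prob (random_graph N (p N)) {E. robber_wins k {..<N} E}"
    using p_le eventually_ge_at_top[of 2]
  proof eventually_elim
    case (elim N)
    let ?pr = "measure_pmf.prob (random_graph N (p N))"
    let ?few = "{E. card (isolated_vertices {..<N} E) \<le> k}"
    define \<mu> where "\<mu> = real N * (1 - p N) ^ (N - 1)"
    have p: "0 \<le> p N" "p N \<le> 1/2" using assms(2)[of N] elim by linarith+
    have \<mu>: "sqrt (real N) \<le> \<mu>"
      unfolding \<mu>_def using elim by (intro sqrt_le_expected_isolated p) auto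
    have \<mu>_pos: "0 < \<mu>"
      using elim by (intro less_le_trans[OF _ \<mu>]) simp
    have "?pr ?few \<le> 4 / \<mu> + 8 * p N"
      using elim \<mu> by (intro prob_few_isolated_le[OF p _ \<mu>_def]) auto
    also have "\<dots> \<le> 4 / sqrt (real N) + 8 * (ln (real N) / (4 * real N))"
      using elim \<mu> \<mu>_pos by (intro add_mono mult_left_mono divide_left_mono mult_pos_pos) auto
    finally have "1 - (4 / sqrt (real N) + 8 * (ln (real N) / (4 * real N))) \<le> 1 - ?pr ?few"
      by simp
    also have "\<dots> = ?pr (- ?few)"
      using measure_pmf.prob_compl[of ?few "random_graph N (p N)"] by (simp add: Compl_eq_Diff_UNIV)
    also have "\<dots> \<le> ?pr {E. robber_wins k {..<N} E}"
      by (intro measure_pmf.finite_measure_mono) (auto intro: robber_wins_if_many_isolated)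
    finally show ?case .
  qed
  have lim: "(\<lambda>N. 1 - (4 / sqrt (real N) + 8 * (ln (real N) / (4 * real N)))) \<longlonglongrightarrow> 1"
    by real_asymp
  show ?thesis
    by (rule tendsto_sandwich[OF lower _ lim tendsto_const]) (simp add: measure_pmf.prob_le_1)
qed

end
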